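(* Let $n \ge 2$ be a natural number, $[n]=\{1,\dots,n\}$, and let $\{D_I\}$ be a family of positive real numbers indexed by all subsets $I\subset [n]$ with $\sharp I \ge 2$. There exists a positive-weighted graph $\mathcal{G}=(G,w)$ (finite, simple, connected) with $V(G)=[n]$ such that $D_I(\mathcal{G})=D_I$ for every $I\subset[n]$ with $\sharp I\ge 2$ if and only if the following two conditions hold: (i) $D_{i,j}\le D_{i,k}+D_{j,k}$ for all distinct $i,j,k\in[n]$; (ii) for every $S\subset [n]$ with $\sharp S\ge 3$, $$D_S=\min_{X}\ \sum_{I\in X} D_I ,$$ where the minimum is over all sets $X$ of $2$-element subsets of $[n]$ such that $G_X$ is a tree and $L(G_X)\subset S\subset V(G_X)$.
   Context: All graphs are finite, simple and connected (except that the auxiliary graphs $G_X$ below are not assumed connected a priori). For a graph $G$, $V(G)$, $E(G)$ and $L(G)$ denote its sets of vertices, edges and leaves (vertices of degree $1$). $\sharp S$ is the cardinality of $S$, and $\subset$ allows equality. A weighted graph $\mathcal{G}=(G,w)$ is a graph $G$ with a function $w:E(G)\to\mathbb{R}$; it is positive-weighted if all $w(e)>0$. For a subgraph $G'$ of $G$, $w(G')$ is the sum of the weights of the edges of $G'$. For $S\subset V(G)$ with $\sharp S\ge 2$, $$D_S(\mathcal{G})=\min\{w(R)\mid R \text{ a connected subgraph of } G \text{ with } S\subset V(R)\}.$$ $D_{i,j}$ is shorthand for $D_{\{i,j\}}$. For a set $X$ of $2$-element subsets of $[n]$, $G_X$ is the graph with edge set $X$ and vertex set $\bigcup_{I\in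 X} I$. *)

theory Defs
  imports Complex_Main
begin

record 'a ugraph =
  verts :: "'a set"
  edges :: "'a set set"

definition simple_graph :: "'a ugraph \<Rightarrow> bool" where
  "simple_graph G \<longleftrightarrow> finite (verts G) \<and> (\<forall>e\<in>edges G. e \<subseteq> verts G \<and> card e = 2)"

definition adjacency :: "'a ugraph \<Rightarrow> 'a rel" where
  "adjacency G = {(u, v). {u, v} \<in> edges G}"

(* The graph without vertices is not counted as connected. *)
definition connected_graph :: "'a ugraph \<Rightarrow> bool" where
  "connected_graph G \<longleftrightarrow>
     verts G \<noteq> {} \<and> (\<forall>u\<in>verts G. \<forall>v\<in>verts G. (u, v) \<in> (adjacency G)\<^sup>*)"

(* A cycle is given by the list of its vertices, without repeating the first one at the end. *)
definition is_cycle :: "'a ugraph \<Rightarrow> 'a list \<Rightarrow> bool" where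
  "is_cycle G p \<longleftrightarrow>
     length p \<ge> 3 \<and> distinct p \<and>
     successively (\<lambda>u v. {u, v} \<in> edges G) p \<and> {last p, hd p} \<in> edges G"

definition tree :: "'a ugraph \<Rightarrow> bool" where
  "tree G \<longleftrightarrow> simple_graph G \<and> connected_graph G \<and> (\<nexists>p. is_cycle G p)"

definition degree :: "'a ugraph \<Rightarrow> 'a \<Rightarrow> nat" where
  "degree G v = card {e \<in> edges G. v \<in> e}"

definition leaves :: "'a ugraph \<Rightarrow> 'a set" where
  "leaves G = {v \<in> verts G. degree G v = 1}"

definition subgraph :: "'a ugraph \<Rightarrow> 'a ugraph \<Rightarrow> bool" where
  "subgraph H G \<longleftrightarrow> simple_graph H \<and> verts H \<subseteq> verts G \<and> edges H \<subseteq> edges G"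

(* Only the values of w on the edges of the graph are meaningful. *)
definition positive_weighted :: "'a ugraph \<Rightarrow> ('a set \<Rightarrow> real) \<Rightarrow> bool" where
  "positive_weighted G w \<longleftrightarrow> (\<forall>e\<in>edges G. w e > 0)"

definition weight :: "('a set \<Rightarrow> real) \<Rightarrow> 'a ugraph \<Rightarrow> real" where
  "weight w H = (\<Sum>e\<in>edges H. w e)"

(* For a finite connected G and a nonempty S \<subseteq> verts G, the set under Min is finite and
   contains the weight of G itself, so Min is a genuine minimum. *)
definition multidist :: "'a ugraph \<Rightarrow> ('a set \<Rightarrow> real) \<Rightarrow> 'a set \<Rightarrow> real" where
  "multidist G w S =
     Min {weight w R | R. subgraph R G \<and> connected_graph R \<and> S \<subseteq> verts R}"

definition graph_of_pairs :: "'a set set \<Rightarrow> 'a ugraph" where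
  "graph_of_pairs X = \<lparr>verts = \<Union>X, edges = X\<rparr>"

definition pairs :: "nat \<Rightarrow> nat set set" where
  "pairs n = {I. I \<subseteq> {1..n} \<and> card I = 2}"

end

theory Submission
  imports Defs
begin

text \<open>
  Both directions rest on one identity, valid for every positive-weighted connected graph
  (\<open>multidist_eq_Min_trees\<close>): the multidistance of a set \<open>S\<close> is determined by the distances of
  pairs, as the least total distance of a tree \<open>X\<close> of pairs that contains \<open>S\<close> and has its leaves
  in \<open>S\<close>.

  No tree gives less than \<open>D\<^sub>S\<close>: replace each pair of \<open>X\<close> by a cheapest connected subgraph that
  joins it. The union of these subgraphs is connected because \<open>X\<close> is, contains \<open>S\<close>, and costs at
  most the sum of the distances (\<open>multidist_le_sum_pairs\<close>). Applied to a path with two edges, the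
  same estimate is the triangle inequality (i).

  Some tree gives exactly \<open>D\<^sub>S\<close>: a cheapest connected subgraph containing \<open>S\<close> has no cycle, since an
  edge of a cycle could be deleted, and no leaf outside \<open>S\<close>, since that leaf could be deleted;
  positive weights make both deletions strict improvements. So the edge set of this subgraph is an
  admissible \<open>X\<close>, and the distance between the ends of an edge is at most the weight of the edge.

  Conversely, given (i) and (ii), take the complete graph on \<open>{1..n}\<close> and let \<open>D {i, j}\<close> be the
  weight of the edge \<open>{i, j}\<close>. By (i) no path is shorter than the edge between its ends
  (\<open>path_weight_ge\<close>), so the graph has the prescribed distances of pairs, and the identity together
  with (ii) transfers this to all larger sets.
\<close>

section \<open>Connectivity\<close>

lemma adjacency_rtrancl_sym:
  "(a, b) \<in> (adjacency G)\<^sup>* \<Longrightarrow> (b, a) \<in> (adjacency G)\<^sup>*"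
proof -
  have "sym (adjacency G)"
    by (auto simp: sym_def adjacency_def insert_commute)
  then show "(a, b) \<in> (adjacency G)\<^sup>* \<Longrightarrow> (b, a) \<in> (adjacency G)\<^sup>*"
    by (meson sym_rtrancl symD)
qed

lemma adjacency_rtrancl_mono:
  assumes "edges H \<subseteq> edges G" and "(a, b) \<in> (adjacency H)\<^sup>*"
  shows "(a, b) \<in> (adjacency G)\<^sup>*"
proof -
  have "adjacency H \<subseteq> adjacency G"
    using assms(1) by (auto simp: adjacency_def)
  then show ?thesis
    using assms(2) rtrancl_mono by blast
qed

lemma adjacency_rtrancl_successively:
  assumes "p \<noteq> []" and "successively (\<lambda>u v. {u, v} \<in> edges G) p"
  shows "(hd p, last p) \<in> (adjacency G)\<^sup>*"
  using assms
proof (induction p rule: induct_list012)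
  case (3 x y zs)
  then have "(x, y) \<in> adjacency G" and "(y, last (y # zs)) \<in> (adjacency G)\<^sup>*"
    by (auto simp: adjacency_def)
  then show ?case
    by (auto intro: converse_rtrancl_into_rtrancl)
qed auto

lemma adjacency_rtrancl_obtains_path:
  assumes "(a, b) \<in> (adjacency G)\<^sup>*"
  obtains p where "p \<noteq> []" "hd p = a" "last p = b" "distinct p"
    "successively (\<lambda>u v. {u, v} \<in> edges G) p"
proof -
  have "\<exists>p. p \<noteq> [] \<and> hd p = a \<and> last p = b \<and> distinct p \<and>
      successively (\<lambda>u v. {u, v} \<in> edges G) p"
    using assms
  proof (induction rule: rtrancl_induct)
    case base
    show ?case by (rule exI[of _ "[a]"]) auto
  next
    case (step y z)
    then obtain p where p: "p \<noteq> []" "hd p = a" "last p = y" "distinct p"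
      "successively (\<lambda>u v. {u, v} \<in> edges G) p" by blast
    show ?case
    proof (cases "z \<in> set p")
      \<comment> \<open>A path that already meets \<open>z\<close> is cut off there, which keeps its vertices distinct.\<close>
      case True
      then obtain xs ys where "p = xs @ z # ys" by (meson split_list)
      then have "p = (xs @ [z]) @ ys" by simp
      with p have "hd (xs @ [z]) = a" "distinct (xs @ [z])"
        "successively (\<lambda>u v. {u, v} \<in> edges G) (xs @ [z])"
        by (auto simp: successively_append_iff hd_append)
      then show ?thesis by (intro exI[of _ "xs @ [z]"]) auto
    next
      case False
      with p step(2) show ?thesis
        by (intro exI[of _ "p @ [z]"]) (auto simp: successively_append_iff adjacency_def)
    qed
  qed
  then show ?thesis using that by blast
qed

lemma Union_edges_connected:
  assumes R: "simple_graph R" "connected_graph R" and "card (verts R) \<ge> 2"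
  shows "\<Union>(edges R) = verts R"
proof
  show "\<Union>(edges R) \<subseteq> verts R"
    using R by (auto simp: simple_graph_def)
  show "verts R \<subseteq> \<Union>(edges R)"
  proof
    fix v assume v: "v \<in> verts R"
    have "\<not> verts R \<subseteq> {v}"
      using card_mono[of "{v}" "verts R"] assms(3) by auto
    then obtain u where "u \<in> verts R" "u \<noteq> v" by blast
    with v R have "(v, u) \<in> (adjacency R)\<^sup>*" by (auto simp: connected_graph_def)
    with \<open>u \<noteq> v\<close> obtain x where "(v, x) \<in> adjacency R"
      by (metis converse_rtranclE)
    then show "v \<in> \<Union>(edges R)" by (auto simp: adjacency_def)
  qed
qed

text \<open>The two deletions that make a cheapest connected subgraph a tree with prescribed leaves.\<close>

lemma connected_delete_cycle_edge:
  assumes R: "connected_graph R" and cyc: "is_cycle R p"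
  shows "connected_graph \<lparr>verts = verts R, edges = edges R - {{last p, hd p}}\<rparr>"
proof -
  let ?e = "{last p, hd p}"
  let ?R = "\<lparr>verts = verts R, edges = edges R - {?e}\<rparr>"
  have len: "length p \<ge> 3" and dist: "distinct p"
    and succ: "successively (\<lambda>u v. {u, v} \<in> edges R) p"
    using cyc by (auto simp: is_cycle_def)
  have "p \<noteq> []" using len by auto
  \<comment> \<open>The rest of the cycle still joins the ends of the deleted edge: with at least three vertices,
    the first and the last one are not consecutive.\<close>
  have "successively (\<lambda>u v. {u, v} \<in> edges ?R) p"
    unfolding successively_conv_nth
  proof (intro allI impI)
    fix i assume i: "Suc i < length p"
    have "{p ! i, p ! Suc i} \<in> edges R"
      using succ i by (auto simp: successively_conv_nth)
    moreover have "{p ! i, p ! Suc i} \<noteq> {p ! (length p - 1), p ! 0}"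
    proof
      assume "{p ! i, p ! Suc i} = {p ! (length p - 1), p ! 0}"
      then have "p ! i = p ! (length p - 1) \<and> p ! Suc i = p ! 0 \<or>
          p ! i = p ! 0 \<and> p ! Suc i = p ! (length p - 1)"
        by (auto simp: doubleton_eq_iff)
      then have "i = length p - 1 \<and> Suc i = 0 \<or> i = 0 \<and> Suc i = length p - 1"
        using nth_eq_iff_index_eq[OF dist] i by (metis Suc_lessD diff_less length_greater_0_conv
            less_one \<open>p \<noteq> []\<close>)
      then show False using len by auto
    qed
    ultimately show "{p ! i, p ! Suc i} \<in> edges ?R"
      using \<open>p \<noteq> []\<close> by (simp add: last_conv_nth hd_conv_nth)
  qed
  with \<open>p \<noteq> []\<close> have path: "(hd p, last p) \<in> (adjacency ?R)\<^sup>*"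
    by (rule adjacency_rtrancl_successively)
  have "adjacency R \<subseteq> (adjacency ?R)\<^sup>*"
  proof clarify
    fix a b assume ab: "(a, b) \<in> adjacency R"
    show "(a, b) \<in> (adjacency ?R)\<^sup>*"
    proof (cases "{a, b} = ?e")
      case True
      then show ?thesis
        using path adjacency_rtrancl_sym[OF path] by (auto simp: doubleton_eq_iff)
    next
      case False
      with ab show ?thesis by (auto simp: adjacency_def)
    qed
  qed
  then have "(adjacency R)\<^sup>* \<subseteq> (adjacency ?R)\<^sup>*"
    by (rule rtrancl_subset_rtrancl)
  with R show ?thesis by (auto simp: connected_graph_def)
qed

lemma connected_delete_leaf:
  assumes R: "simple_graph R" "connected_graph R"
    and e: "{f \<in> edges R. v \<in> f} = {e}" and "v \<in> verts R"
  shows "connected_graph \<lparr>verts = verts R - {v}, edges = edges R - {e}\<rparr>"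
proof -
  let ?R = "\<lparr>verts = verts R - {v}, edges = edges R - {e}\<rparr>"
  have "e \<in> edges R" "v \<in> e" using e by auto
  with R have "e \<subseteq> verts R" "card e = 2" by (auto simp: simple_graph_def)
  with \<open>v \<in> e\<close> obtain u where u: "e = {v, u}" "u \<noteq> v"
    by (auto simp: card_2_iff)
  have only: "y = u" if "{v, y} \<in> edges R" for y
  proof -
    have "{v, y} \<in> {f \<in> edges R. v \<in> f}" using that by simp
    then have "{v, y} = {v, u}" unfolding e u(1) by simp
    then show ?thesis using u by (auto simp: doubleton_eq_iff)
  qed
  \<comment> \<open>A walk can visit \<open>v\<close> only by going back and forth between \<open>u\<close> and \<open>v\<close>; such a detour is
    replaced by waiting at \<open>u\<close>.\<close>
  have walk: "(a, if y = v then u else y) \<in> (adjacency ?R)\<^sup>*"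
    if "(a, y) \<in> (adjacency R)\<^sup>*" and "a \<noteq> v" for a y
    using that(1)
  proof (induction rule: rtrancl_induct)
    case base
    then show ?case using that(2) by simp
  next
    case (step y z)
    have edge: "{y, z} \<in> edges R" using step(2) by (simp add: adjacency_def)
    consider "z = v" "y = v" | "z = v" "y \<noteq> v" | "z \<noteq> v" "y = v" | "z \<noteq> v" "y \<noteq> v" by blast
    then show ?case
    proof cases
      case 1 then show ?thesis using step.IH by simp
    next
      case 2
      then have "y = u" using edge only by (simp add: insert_commute)
      then show ?thesis using 2 step.IH by simp
    next
      case 3
      then have "z = u" using edge only by simp
      then show ?thesis using 3 step.IH by simp
    next
      case 4
      then have "(y, z) \<in> adjacency ?R"
        using edge \<open>v \<in> e\<close> by (auto simp: adjacency_def)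
      then show ?thesis using 4 step.IH by simp
    qed
  qed
  have "(a, b) \<in> (adjacency ?R)\<^sup>*" if "a \<in> verts R - {v}" "b \<in> verts R - {v}" for a b
    using walk[of a b] that R by (auto simp: connected_graph_def)
  moreover have "u \<in> verts R - {v}" using u \<open>e \<subseteq> verts R\<close> by auto
  ultimately show ?thesis by (auto simp: connected_graph_def)
qed

section \<open>Multidistances and trees of pairs\<close>

lemma finite_connected_subgraph_weights:
  assumes "simple_graph G"
  shows "finite {weight w R | R. subgraph R G \<and> connected_graph R \<and> S \<subseteq> verts R}"
proof (rule finite_subset)
  show "{weight w R | R. subgraph R G \<and> connected_graph R \<and> S \<subseteq> verts R}
      \<subseteq> sum w ` Pow (edges G)"
    by (auto simp: weight_def subgraph_def)
  have "edges G \<subseteq> Pow (verts G)" "finite (verts G)"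
    using assms by (auto simp: simple_graph_def)
  then show "finite (sum w ` Pow (edges G))"
    by (meson finite_Pow_iff finite_imageI finite_subset)
qed

lemma finite_edges: "simple_graph G \<Longrightarrow> finite (edges G)"
  by (rule finite_subset[of _ "Pow (verts G)"]) (auto simp: simple_graph_def)

lemma multidist_le_weight:
  assumes "simple_graph G" "subgraph R G" "connected_graph R" "S \<subseteq> verts R"
  shows "multidist G w S \<le> weight w R"
  unfolding multidist_def
  by (rule Min_le[OF finite_connected_subgraph_weights]) (use assms in auto)

lemma multidist_attained:
  assumes G: "simple_graph G" "connected_graph G" and "S \<subseteq> verts G"
  obtains R where "subgraph R G" "connected_graph R" "S \<subseteq> verts R" "weight w R = multidist G w S"
proof -
  have "subgraph G G" using G by (simp add: subgraph_def)
  then have "{weight w R | R. subgraph R G \<and> connected_graph R \<and> S \<subseteq> verts R} \<noteq> {}"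
    using assms by auto
  from Min_in[OF finite_connected_subgraph_weights[OF G(1)] this] show ?thesis
    using that unfolding multidist_def by auto
qed

lemma multidist_edge_le:
  assumes "simple_graph G" "e \<in> edges G"
  shows "multidist G w e \<le> w e"
proof -
  let ?R = "\<lparr>verts = e, edges = {e}\<rparr>"
  have e: "e \<subseteq> verts G" "card e = 2" using assms by (auto simp: simple_graph_def)
  then have "finite e" by (simp add: card_ge_0_finite)
  with e assms have "subgraph ?R G"
    by (auto simp: subgraph_def simple_graph_def)
  moreover have "connected_graph ?R"
    using e(2) by (auto simp: card_2_iff connected_graph_def adjacency_def insert_commute)
  ultimately have "multidist G w e \<le> weight w ?R"
    using assms(1) by (intro multidist_le_weight) auto
  then show ?thesis by (simp add: weight_def)
qed

lemma sum_UN_le: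
  fixes f :: "'b \<Rightarrow> real"
  assumes "finite I" "\<And>i. i \<in> I \<Longrightarrow> finite (A i)" "\<And>i x. i \<in> I \<Longrightarrow> x \<in> A i \<Longrightarrow> f x \<ge> 0"
  shows "sum f (\<Union>i\<in>I. A i) \<le> (\<Sum>i\<in>I. sum f (A i))"
  using assms
proof (induction I rule: finite_induct)
  case (insert i I)
  let ?U = "\<Union>i\<in>I. A i"
  have fin: "finite (A i)" "finite ?U" using insert.hyps insert.prems(1) by auto
  have "sum f (A i \<inter> ?U) \<ge> 0"
    using insert.prems(2) by (intro sum_nonneg) auto
  then have "sum f (A i \<union> ?U) \<le> sum f (A i) + sum f ?U"
    using sum.union_inter[OF fin, of f] by linarith
  also have "sum f ?U \<le> (\<Sum>i\<in>I. sum f (A i))"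
    using insert.prems by (intro insert.IH) auto
  finally show ?case using insert.hyps by simp
qed simp

text \<open>
  Joining the pairs of \<open>X\<close> separately, each at its optimal cost, produces a connected subgraph; an
  edge used for several pairs is paid for only once, hence the inequality.
\<close>

lemma multidist_le_sum_pairs:
  assumes G: "simple_graph G" "connected_graph G" and pos: "positive_weighted G w"
    and X: "finite X" "\<And>I. I \<in> X \<Longrightarrow> I \<subseteq> verts G" "\<And>I. I \<in> X \<Longrightarrow> I \<noteq> {}"
    and conn: "connected_graph (graph_of_pairs X)" and S: "S \<subseteq> \<Union>X"
  shows "multidist G w S \<le> (\<Sum>I\<in>X. multidist G w I)"
proof -
  have "\<exists>R. subgraph R G \<and> connected_graph R \<and> I \<subseteq> verts R \<and> weight w R = multidist G w I"
    if "I \<in> X" for I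
    using multidist_attained[OF G X(2)[OF that], of w] by metis
  then obtain R where R: "\<And>I. I \<in> X \<Longrightarrow> subgraph (R I) G"
      "\<And>I. I \<in> X \<Longrightarrow> connected_graph (R I)" "\<And>I. I \<in> X \<Longrightarrow> I \<subseteq> verts (R I)"
      "\<And>I. I \<in> X \<Longrightarrow> weight w (R I) = multidist G w I"
    by metis
  define U where "U = \<lparr>verts = (\<Union>I\<in>X. verts (R I)), edges = (\<Union>I\<in>X. edges (R I))\<rparr>"
  have "verts U \<subseteq> verts G"
    using R(1) by (auto simp: U_def subgraph_def)
  moreover have "finite (verts G)" using G by (simp add: simple_graph_def)
  ultimately have "finite (verts U)" by (meson finite_subset)
  then have sub: "subgraph U G"
    using R(1) unfolding U_def subgraph_def simple_graph_def by fastforce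
  have sub_edges: "edges (R I) \<subseteq> edges U" if "I \<in> X" for I
    using that by (auto simp: U_def)
  have inner: "(a, b) \<in> (adjacency U)\<^sup>*" if "I \<in> X" "a \<in> verts (R I)" "b \<in> verts (R I)" for I a b
    using R(2)[OF that(1)] that adjacency_rtrancl_mono[OF sub_edges[OF that(1)]]
    by (auto simp: connected_graph_def)
  have "adjacency (graph_of_pairs X) \<subseteq> (adjacency U)\<^sup>*"
  proof clarify
    fix a b assume "(a, b) \<in> adjacency (graph_of_pairs X)"
    then have "{a, b} \<in> X" by (simp add: adjacency_def graph_of_pairs_def)
    with R(3)[OF this] show "(a, b) \<in> (adjacency U)\<^sup>*"
      by (intro inner[of "{a, b}"]) auto
  qed
  then have gr: "(adjacency (graph_of_pairs X))\<^sup>* \<subseteq> (adjacency U)\<^sup>*"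
    by (rule rtrancl_subset_rtrancl)
  then have outer: "(a, b) \<in> (adjacency U)\<^sup>*" if "a \<in> \<Union>X" "b \<in> \<Union>X" for a b
  proof -
    have "a \<in> verts (graph_of_pairs X)" "b \<in> verts (graph_of_pairs X)"
      using that by (auto simp: graph_of_pairs_def)
    then have "(a, b) \<in> (adjacency (graph_of_pairs X))\<^sup>*"
      using conn unfolding connected_graph_def by blast
    then show ?thesis using gr by blast
  qed
  have "connected_graph U"
    unfolding connected_graph_def
  proof (intro conjI ballI)
    obtain x where "x \<in> \<Union>X" using conn by (auto simp: connected_graph_def graph_of_pairs_def)
    then show "verts U \<noteq> {}" using R(3) by (auto simp: U_def)
  next
    fix a b assume "a \<in> verts U" "b \<in> verts U"
    then obtain I J where I: "I \<in> X" "a \<in> verts (R I)" and J: "J \<in> X" "b \<in> verts (R J)"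
      by (auto simp: U_def)
    obtain a' b' where a': "a' \<in> I" and b': "b' \<in> J" using X(3) I(1) J(1) by blast
    have "(a, a') \<in> (adjacency U)\<^sup>*" using inner[OF I] R(3) I(1) a' by blast
    also have "(a', b') \<in> (adjacency U)\<^sup>*" using outer a' b' I(1) J(1) by blast
    also have "(b', b) \<in> (adjacency U)\<^sup>*" using inner[OF J(1) _ J(2)] R(3) J(1) b' by blast
    finally show "(a, b) \<in> (adjacency U)\<^sup>*" .
  qed
  moreover have "S \<subseteq> verts U" using S R(3) by (fastforce simp: U_def)
  ultimately have "multidist G w S \<le> weight w U"
    using sub G(1) by (intro multidist_le_weight)
  also have "weight w U = sum w (\<Union>I\<in>X. edges (R I))" by (simp add: weight_def U_def)
  also have "\<dots> \<le> (\<Sum>I\<in>X. sum w (edges (R I)))"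
  proof (rule sum_UN_le[OF X(1)])
    fix I assume I: "I \<in> X"
    then show "finite (edges (R I))" using R(1) by (auto simp: subgraph_def finite_edges)
    fix e assume "e \<in> edges (R I)"
    then have "e \<in> edges G" using R(1)[OF I] by (auto simp: subgraph_def)
    then show "w e \<ge> 0" using pos by (simp add: positive_weighted_def less_imp_le)
  qed
  also have "\<dots> = (\<Sum>I\<in>X. multidist G w I)"
    using R(4) by (simp add: weight_def)
  finally show ?thesis .
qed

lemma multidist_triangle:
  assumes G: "simple_graph G" "connected_graph G" and pos: "positive_weighted G w"
    and "i \<in> verts G" "j \<in> verts G" "k \<in> verts G" "i \<noteq> j"
  shows "multidist G w {i, j} \<le> multidist G w {i, k} + multidist G w {j, k}"
proof -
  let ?A = "adjacency (graph_of_pairs {{i, k}, {j, k}})"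
  have "(i, k) \<in> ?A" "(k, i) \<in> ?A" "(j, k) \<in> ?A" "(k, j) \<in> ?A"
    by (auto simp: adjacency_def graph_of_pairs_def insert_commute)
  then have "connected_graph (graph_of_pairs {{i, k}, {j, k}})"
    unfolding connected_graph_def
    by (auto simp: graph_of_pairs_def intro: rtrancl_trans[OF r_into_rtrancl r_into_rtrancl])
  then have "multidist G w {i, j} \<le> (\<Sum>I\<in>{{i, k}, {j, k}}. multidist G w I)"
    by (intro multidist_le_sum_pairs[OF G pos]) (use assms in auto)
  moreover have "{i, k} \<noteq> {j, k}" using \<open>i \<noteq> j\<close> by (auto simp: doubleton_eq_iff)
  ultimately show ?thesis by simp
qed

lemma multidist_attained_tree:
  assumes G: "simple_graph G" "connected_graph G" and pos: "positive_weighted G w"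
    and S: "S \<subseteq> verts G"
  obtains R where "subgraph R G" "tree R" "leaves R \<subseteq> S" "S \<subseteq> verts R"
    "weight w R = multidist G w S"
proof -
  obtain R where R: "subgraph R G" "connected_graph R" "S \<subseteq> verts R"
      "weight w R = multidist G w S"
    using multidist_attained[OF G S] .
  have simple: "simple_graph R" using R(1) by (simp add: subgraph_def)
  have no_deletion: False
    if e: "e \<in> edges R" and V: "V \<subseteq> verts R" "S \<subseteq> V" "\<forall>f\<in>edges R - {e}. f \<subseteq> V"
      and conn: "connected_graph \<lparr>verts = V, edges = edges R - {e}\<rparr>" for e V
  proof -
    let ?R = "\<lparr>verts = V, edges = edges R - {e}\<rparr>"
    have "finite V" using V(1) simple by (auto simp: simple_graph_def intro: finite_subset)
    then have "subgraph ?R G"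
      using R(1) V simple by (auto simp: subgraph_def simple_graph_def)
    then have "multidist G w S \<le> weight w ?R"
      using G(1) conn V(2) by (intro multidist_le_weight) auto
    also have "\<dots> = weight w R - w e"
      using e finite_edges[OF simple] by (simp add: weight_def sum_diff1)
    also have "\<dots> < weight w R"
      using e R(1) pos by (auto simp: subgraph_def positive_weighted_def)
    finally show False using R(4) by simp
  qed
  have "\<not> is_cycle R p" for p
  proof
    assume p: "is_cycle R p"
    show False
    proof (rule no_deletion)
      show "{last p, hd p} \<in> edges R" using p by (simp add: is_cycle_def)
      show "connected_graph \<lparr>verts = verts R, edges = edges R - {{last p, hd p}}\<rparr>"
        using connected_delete_cycle_edge[OF R(2) p] .
    qed (use R simple in \<open>auto simp: simple_graph_def\<close>)
  qed
  then have "tree R" using simple R(2) by (auto simp: tree_def)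
  moreover have "leaves R \<subseteq> S"
  proof (rule ccontr)
    assume "\<not> leaves R \<subseteq> S"
    then obtain v where v: "v \<in> verts R" "degree R v = 1" "v \<notin> S" by (auto simp: leaves_def)
    then obtain e where e: "{f \<in> edges R. v \<in> f} = {e}"
      by (auto simp: degree_def card_1_singleton_iff)
    show False
    proof (rule no_deletion)
      show "e \<in> edges R" using e by auto
      show "connected_graph \<lparr>verts = verts R - {v}, edges = edges R - {e}\<rparr>"
        using connected_delete_leaf[OF simple R(2) e v(1)] .
      show "\<forall>f\<in>edges R - {e}. f \<subseteq> verts R - {v}"
      proof
        fix f assume f: "f \<in> edges R - {e}"
        then have "v \<notin> f" using e by blast
        with f simple show "f \<subseteq> verts R - {v}" unfolding simple_graph_def by blast
      qed
    qed (use R(3) v(3) in auto)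
  qed
  ultimately show ?thesis using that R by blast
qed

theorem multidist_eq_Min_trees:
  assumes G: "simple_graph G" "connected_graph G" and pos: "positive_weighted G w"
    and S: "S \<subseteq> verts G" "card S \<ge> 2"
  shows "multidist G w S = Min {\<Sum>I\<in>X. multidist G w I | X.
    X \<subseteq> {I. I \<subseteq> verts G \<and> card I = 2} \<and> tree (graph_of_pairs X) \<and>
    leaves (graph_of_pairs X) \<subseteq> S \<and> S \<subseteq> verts (graph_of_pairs X)}"
    (is "_ = Min ?M")
proof -
  let ?P = "{I. I \<subseteq> verts G \<and> card I = 2}"
  have fin: "finite (verts G)" using G(1) by (simp add: simple_graph_def)
  then have finP: "finite ?P" by simp
  have le: "multidist G w S \<le> (\<Sum>I\<in>X. multidist G w I)"
    if X: "X \<subseteq> ?P" "tree (graph_of_pairs X)" "S \<subseteq> verts (graph_of_pairs X)" for X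
  proof (rule multidist_le_sum_pairs[OF G pos])
    show "finite X" using X(1) finP by (rule finite_subset)
    show "connected_graph (graph_of_pairs X)" using X(2) by (simp add: tree_def)
    show "S \<subseteq> \<Union>X" using X(3) by (simp add: graph_of_pairs_def)
  qed (use X(1) in auto)
  have "finite ?M"
    by (rule finite_subset[of _ "sum (multidist G w) ` Pow ?P"]) (use finP in auto)
  moreover have "multidist G w S \<in> ?M"
  proof -
    obtain R where R: "subgraph R G" "tree R" "leaves R \<subseteq> S" "S \<subseteq> verts R"
        "weight w R = multidist G w S"
      using multidist_attained_tree[OF G pos S(1)] .
    have simple: "simple_graph R" and conn: "connected_graph R" using R(2) by (auto simp: tree_def)
    have "card (verts R) \<ge> 2"
      using card_mono[OF _ R(4)] S(2) simple by (auto simp: simple_graph_def)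
    then have gr: "graph_of_pairs (edges R) = R"
      using Union_edges_connected[OF simple conn] by (simp add: graph_of_pairs_def)
    have inP: "edges R \<subseteq> ?P"
      using R(1) G(1) by (auto simp: subgraph_def simple_graph_def)
    have "(\<Sum>I\<in>edges R. multidist G w I) \<le> weight w R"
      unfolding weight_def using R(1) G(1)
      by (intro sum_mono multidist_edge_le) (auto simp: subgraph_def)
    moreover have "multidist G w S \<le> (\<Sum>I\<in>edges R. multidist G w I)"
      using le[OF inP] gr R by simp
    ultimately have "multidist G w S = (\<Sum>I\<in>edges R. multidist G w I)" using R(5) by simp
    then show ?thesis
      using inP gr R by (auto intro!: exI[of _ "edges R"])
  qed
  moreover have "multidist G w S \<le> m" if "m \<in> ?M" for m
    using that le by auto
  ultimately show ?thesis by (metis (no_types, lifting) Min_eqI)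
qed

section \<open>The complete graph of a metric\<close>

text \<open>
  Summing over all edges inside the vertex set of the path, rather than over the edges of the path
  itself, makes the induction step immediate: the first edge is not contained in the remaining
  vertices, because the vertices are distinct.
\<close>

lemma path_weight_ge:
  fixes D :: "'a set \<Rightarrow> real"
  assumes tri: "\<And>i j k. i \<in> V \<Longrightarrow> j \<in> V \<Longrightarrow> k \<in> V \<Longrightarrow> i \<noteq> j \<Longrightarrow> i \<noteq> k \<Longrightarrow> j \<noteq> k \<Longrightarrow>
      D {i, j} \<le> D {i, k} + D {j, k}"
    and E: "finite E" "\<And>e. e \<in> E \<Longrightarrow> D e \<ge> 0"
  shows "length p \<ge> 2 \<Longrightarrow> distinct p \<Longrightarrow> set p \<subseteq> V \<Longrightarrow> successively (\<lambda>u v. {u, v} \<in> E) p \<Longrightarrow>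
    D {hd p, last p} \<le> (\<Sum>e\<in>{e \<in> E. e \<subseteq> set p}. D e)"
proof (induction p rule: induct_list012)
  case (3 x y zs)
  let ?F = "{e \<in> E. e \<subseteq> set (y # zs)}"
  have xy: "{x, y} \<in> E" "{x, y} \<notin> ?F" "x \<noteq> y" using 3 by auto
  have "D {x, y} + (\<Sum>e\<in>?F. D e) = (\<Sum>e\<in>insert {x, y} ?F. D e)"
    using xy E(1) by simp
  also have "\<dots> \<le> (\<Sum>e\<in>{e \<in> E. e \<subseteq> set (x # y # zs)}. D e)"
    using E xy(1) by (intro sum_mono2) auto
  finally have sum: "D {x, y} + (\<Sum>e\<in>?F. D e) \<le> (\<Sum>e\<in>{e \<in> E. e \<subseteq> set (x # y # zs)}. D e)" .
  show ?case
  proof (cases "zs = []")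
    case True
    moreover have "(\<Sum>e\<in>?F. D e) \<ge> 0" using E(2) by (intro sum_nonneg) auto
    ultimately show ?thesis using sum by simp
  next
    case False
    let ?l = "last zs"
    have l: "?l \<in> set zs" using False by simp
    have "D {x, ?l} \<le> D {x, y} + D {?l, y}"
      using 3(4,5) l by (intro tri) auto
    moreover have "D {y, ?l} \<le> (\<Sum>e\<in>?F. D e)"
      using 3(2)[OF _ _ _] 3(4-6) False by (cases zs) auto
    ultimately show ?thesis using sum False by (simp add: insert_commute)
  qed
qed auto

lemma multidist_complete_graph_pair:
  fixes D :: "'a set \<Rightarrow> real"
  defines "P \<equiv> \<lambda>V. {I. I \<subseteq> V \<and> card I = 2}"
  assumes V: "finite V" "i \<in> V" "j \<in> V" "i \<noteq> j"
    and pos: "\<And>I. I \<in> P V \<Longrightarrow> D I > 0"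
    and tri: "\<And>i j k. i \<in> V \<Longrightarrow> j \<in> V \<Longrightarrow> k \<in> V \<Longrightarrow> i \<noteq> j \<Longrightarrow> i \<noteq> k \<Longrightarrow> j \<noteq> k \<Longrightarrow>
      D {i, j} \<le> D {i, k} + D {j, k}"
    and conn: "connected_graph \<lparr>verts = V, edges = P V\<rparr>"
  shows "multidist \<lparr>verts = V, edges = P V\<rparr> D {i, j} = D {i, j}"
proof (rule antisym)
  let ?G = "\<lparr>verts = V, edges = P V\<rparr>"
  have G: "simple_graph ?G" using V(1) by (auto simp: simple_graph_def P_def)
  have "{i, j} \<in> edges ?G" using V by (auto simp: P_def)
  with G show "multidist ?G D {i, j} \<le> D {i, j}" by (rule multidist_edge_le)
  obtain R where R: "subgraph R ?G" "connected_graph R" "{i, j} \<subseteq> verts R"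
      "weight D R = multidist ?G D {i, j}"
    using multidist_attained[OF G conn, of "{i, j}"] V by auto
  have simple: "simple_graph R" using R(1) by (simp add: subgraph_def)
  have pos_R: "D e \<ge> 0" if "e \<in> edges R" for e
    using pos[of e] that R(1) by (auto simp: subgraph_def)
  have "(i, j) \<in> (adjacency R)\<^sup>*" using R(2,3) by (auto simp: connected_graph_def)
  then obtain p where p: "p \<noteq> []" "hd p = i" "last p = j" "distinct p"
      "successively (\<lambda>u v. {u, v} \<in> edges R) p"
    by (rule adjacency_rtrancl_obtains_path)
  have "length p \<ge> 2" using p(1-3) \<open>i \<noteq> j\<close> by (cases p rule: remdups_adj.cases) auto
  moreover have "set p \<subseteq> V"
  proof
    fix x assume "x \<in> set p"
    then obtain q r where "p = (q @ [x]) @ r" using split_list by fastforce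
    then have "successively (\<lambda>u v. {u, v} \<in> edges R) (q @ [x])" "hd (q @ [x]) = i"
      using p(2,5) by (auto simp: successively_append_iff hd_append)
    then have "(i, x) \<in> (adjacency R)\<^sup>*"
      using adjacency_rtrancl_successively[of "q @ [x]" R] by simp
    then show "x \<in> V"
      using V(2) R(1) by (cases rule: rtranclE) (auto simp: adjacency_def subgraph_def P_def)
  qed
  ultimately have "D {i, j} \<le> (\<Sum>e\<in>{e \<in> edges R. e \<subseteq> set p}. D e)"
    using path_weight_ge[of V D "edges R" p, OF tri finite_edges[OF simple] pos_R] p by auto
  also have "\<dots> \<le> weight D R"
    unfolding weight_def using pos_R finite_edges[OF simple] by (intro sum_mono2) auto
  finally show "D {i, j} \<le> multidist ?G D {i, j}" using R(4) by simp
qed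

lemma connected_complete_graph:
  assumes "V \<noteq> {}"
  shows "connected_graph \<lparr>verts = V, edges = {I. I \<subseteq> V \<and> card I = 2}\<rparr>"
  unfolding connected_graph_def
proof (intro conjI ballI)
  let ?G = "\<lparr>verts = V, edges = {I. I \<subseteq> V \<and> card I = 2}\<rparr>"
  show "verts ?G \<noteq> {}" using assms by simp
  fix u v assume "u \<in> verts ?G" "v \<in> verts ?G"
  then show "(u, v) \<in> (adjacency ?G)\<^sup>*"
    by (cases "u = v") (auto simp: adjacency_def)
qed

section \<open>Families of multidistances\<close>

theorem theorem9:
  fixes n :: nat and D :: "nat set \<Rightarrow> real"
  assumes "n \<ge> 2"
    and "\<And>I. I \<subseteq> {1..n} \<Longrightarrow> card I \<ge> 2 \<Longrightarrow> D I > 0"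
  shows
    "(\<exists>(G :: nat ugraph) w.
        simple_graph G \<and> connected_graph G \<and> verts G = {1..n} \<and> positive_weighted G w \<and>
        (\<forall>I. I \<subseteq> {1..n} \<and> card I \<ge> 2 \<longrightarrow> multidist G w I = D I))
     \<longleftrightarrow>
     (\<forall>i\<in>{1..n}. \<forall>j\<in>{1..n}. \<forall>k\<in>{1..n}. i \<noteq> j \<and> i \<noteq> k \<and> j \<noteq> k \<longrightarrow>
        D {i, j} \<le> D {i, k} + D {j, k}) \<and>
     (\<forall>S. S \<subseteq> {1..n} \<and> card S \<ge> 3 \<longrightarrow>
        D S = Min {\<Sum>I\<in>X. D I | X. X \<subseteq> pairs n \<and> tree (graph_of_pairs X) \<and>
                     leaves (graph_of_pairs X) \<subseteq> S \<and> S \<subseteq> verts (graph_of_pairs X)})"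
    (is "?realizable \<longleftrightarrow> ?triangle \<and> ?trees")
proof -
  have Min_trees: "multidist G w S = Min {\<Sum>I\<in>X. D I | X. X \<subseteq> pairs n \<and>
      tree (graph_of_pairs X) \<and> leaves (graph_of_pairs X) \<subseteq> S \<and> S \<subseteq> verts (graph_of_pairs X)}"
    if G: "simple_graph G" "connected_graph G" "verts G = {1..n}" "positive_weighted G w"
      and D: "\<And>I. I \<in> pairs n \<Longrightarrow> multidist G w I = D I"
      and S: "S \<subseteq> {1..n}" "card S \<ge> 3" for G :: "nat ugraph" and w S
  proof -
    have sums: "(\<Sum>I\<in>X. multidist G w I) = (\<Sum>I\<in>X. D I)" if "X \<subseteq> pairs n" for X
      using that D by (intro sum.cong) auto
    have "multidist G w S = Min {\<Sum>I\<in>X. multidist G w I | X. X \<subseteq> pairs n \<and>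
      tree (graph_of_pairs X) \<and> leaves (graph_of_pairs X) \<subseteq> S \<and> S \<subseteq> verts (graph_of_pairs X)}"
      using multidist_eq_Min_trees[OF G(1,2,4), of S] S G(3) unfolding pairs_def by auto
    also have "{\<Sum>I\<in>X. multidist G w I | X. X \<subseteq> pairs n \<and>
        tree (graph_of_pairs X) \<and> leaves (graph_of_pairs X) \<subseteq> S \<and> S \<subseteq> verts (graph_of_pairs X)}
      = {\<Sum>I\<in>X. D I | X. X \<subseteq> pairs n \<and>
        tree (graph_of_pairs X) \<and> leaves (graph_of_pairs X) \<subseteq> S \<and> S \<subseteq> verts (graph_of_pairs X)}"
      by (intro Collect_cong ex_cong1) (use sums in auto)
    finally show ?thesis .
  qed
  show ?thesis
  proof
    assume ?realizable
    then obtain G :: "nat ugraph" and w where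
      G: "simple_graph G" "connected_graph G" "verts G = {1..n}" "positive_weighted G w"
      and "\<forall>I. I \<subseteq> {1..n} \<and> card I \<ge> 2 \<longrightarrow> multidist G w I = D I"
      by (elim exE conjE)
    then have D: "\<And>I. I \<subseteq> {1..n} \<Longrightarrow> card I \<ge> 2 \<Longrightarrow> multidist G w I = D I"
      by simp
    have ?triangle
    proof (intro ballI impI)
      fix i j k assume "i \<in> {1..n}" "j \<in> {1..n}" "k \<in> {1..n}" and "i \<noteq> j \<and> i \<noteq> k \<and> j \<noteq> k"
      then show "D {i, j} \<le> D {i, k} + D {j, k}"
        using multidist_triangle[OF G(1,2,4), of i j k] G(3) D[of "{i, j}"] D[of "{i, k}"]
          D[of "{j, k}"] by simp
    qed
    moreover have ?trees
    proof (intro allI impI)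
      fix S :: "nat set" assume S: "S \<subseteq> {1..n} \<and> card S \<ge> 3"
      then have "multidist G w S = D S" by (intro D) auto
      with S show "D S = Min {\<Sum>I\<in>X. D I | X. X \<subseteq> pairs n \<and> tree (graph_of_pairs X) \<and>
          leaves (graph_of_pairs X) \<subseteq> S \<and> S \<subseteq> verts (graph_of_pairs X)}"
        using Min_trees[OF G _ , of S] D by (simp add: pairs_def)
    qed
    ultimately show "?triangle \<and> ?trees" ..
  next
    assume cond: "?triangle \<and> ?trees"
    define G where "G = \<lparr>verts = {1..n}, edges = {I. I \<subseteq> {1..n} \<and> card I = 2}\<rparr>"
    have simple: "simple_graph G" by (auto simp: G_def simple_graph_def)
    have conn: "connected_graph G"
      unfolding G_def using assms(1) by (intro connected_complete_graph) auto
    have verts: "verts G = {1..n}" by (simp add: G_def)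
    have pos: "positive_weighted G D"
      using assms(2) by (auto simp: G_def positive_weighted_def)
    have pair: "multidist G D I = D I" if "I \<in> pairs n" for I
    proof -
      have "I \<subseteq> {1..n}" "card I = 2" using that by (auto simp: pairs_def)
      then obtain i j where I: "I = {i, j}" "i \<noteq> j" "i \<in> {1..n}" "j \<in> {1..n}"
        unfolding card_2_iff by blast
      show ?thesis
        unfolding I(1) G_def
        by (rule multidist_complete_graph_pair)
          (use I conn cond assms(2) in \<open>auto simp: G_def\<close>)
    qed
    have "multidist G D I = D I" if "I \<subseteq> {1..n}" "card I \<ge> 2" for I
    proof (cases "card I = 2")
      case True
      with that pair show ?thesis by (simp add: pairs_def)
    next
      case False
      with that have "card I \<ge> 3" by simp
      with that(1) cond show ?thesis
        using Min_trees[OF simple conn verts pos pair, of I] by simp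
    qed
    with simple conn verts pos show ?realizable by blast
  qed
qed

end
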